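(* Let $V$ be an $m\times n$ max-plus matrix with at least one entry different from $-\infty$ in each column, and let $S=(S_1,\dots,S_m)$ be an $m$-tuple of subsets of $\{1,\dots,n\}$ such that $V_{ji}\ne-\infty$ whenever $i\in S_j$. Let $$X_S=\{y\in\mathbb{R}^m : V_{ki}-V_{ji}\le y_k-y_j \text{ for all } j,k\in\{1,\dots,m\} \text{ and } i\in S_j\},$$ and let $V^S$ be the $m\times m$ max-plus matrix whose $j$-th column is given by $V^S_{kj}=\max_{i\in S_j}(V_{ki}-V_{ji})$ for $k=1,\dots,m$ if $S_j\neq\emptyset$, and by $V^S_{jj}=0$, $V^S_{kj}=-\infty$ for $k\ne j$, if $S_j=\emptyset$. Then: 1) $X_S$ is nonempty if and only if $\lambda(V^S)\le 0$; 2) if $\lambda(V^S)\le 0$, then $X_S=\mathrm{span}((V^S)^* )\cap\mathbb{R}^m$, i.e. $X_S$ is the set of $y\in\mathrm{span}((V^S)^* )$ with full support; 3) if $\lambda(V^S)\le 0$, then $X_S=\{x\in\mathbb{R}^m : V^S_{ij}\le x_i-x_j \text{ for all } i\ne j \text{ such that } V^S_{ij}=(V^S)^*_{ij}\}$.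
   Context: All arithmetic is written conventionally on $\mathbb{R}_{\max}=\mathbb{R}\cup\{-\infty\}$, the semiring with addition $\oplus=\max$ and multiplication $\odot=+$ (with $\alpha+(-\infty)=-\infty$); its zero is $-\infty$ and its unity is the real number $0$. A max-plus matrix is a matrix with entries in $\mathbb{R}_{\max}$; products are $(A\odot B)_{ij}=\max_k (A_{ik}+B_{kj})$, sums are entrywise maxima, and $I$ is the max-plus identity matrix ($0$ on the diagonal, $-\infty$ elsewhere). Maximal cycle mean of an $m\times m$ matrix $A$: $\lambda(A)=\max_{\tau}\frac{1}{|K(\tau)|}\sum_{i\in K(\tau)}A_{i\tau(i)}$, where $\tau$ ranges over all cyclic permutations of nonempty subsets $K(\tau)\subseteq\{1,\dots,m\}$ (singletons included). Closure: $A^*=I\oplus A\oplus A^2\oplus\cdots$ (entrywise supremum of max-plus powers); it exists when $\lambda(A)\le 0$. $\mathrm{span}(M)$ is the set of all max-plus linear combinations $\bigoplus_j\alpha_j\odot M_{\cdot j}$, $\alpha_j\in\mathbb{R}_{\max}$, of the columns of $M$. A vector has full support if all its components are real. The combinatorial type of $y\in\mathbb{R}^m$ with respect to $V$ is the $m$-tuple $S$ with $i\in S_j$ iff $\max_k (V_{ki}-y_k)=V_{ji}-y_j$; the sets $X_S$ are the (candidate) cells of the associated cellular decomposition of $\mathbb{R}^m$. *)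

theory Defs
  imports "HOL-Analysis.Analysis" "HOL-Combinatorics.Orbits"
begin

text \<open>
  The max-plus semiring is the subset of \<^typ>\<open>ereal\<close> without \<open>\<infinity>\<close>, with addition \<^const>\<open>max\<close>
  and multiplication the \<open>+\<close> of \<^typ>\<open>ereal\<close>. On that subset \<open>+\<close> has \<open>-\<infinity>\<close> as absorbing element,
  as required; the value \<open>\<infinity>\<close>, for which \<open>\<infinity> + (-\<infinity>) = \<infinity>\<close>, is excluded by the predicate
  below and by the range of the coefficients in the span.
\<close>

definition mp_matrix :: "ereal ^ 'n ^ 'm \<Rightarrow> bool" where
  "mp_matrix A \<longleftrightarrow> (\<forall>i j. A $ i $ j \<noteq> \<infinity>)"

definition mp_mult :: "ereal ^ 'k::finite ^ 'm \<Rightarrow> ereal ^ 'n ^ 'k \<Rightarrow> ereal ^ 'n ^ 'm"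
    (infixl \<open>\<odot>\<close> 70) where
  "A \<odot> B = (\<chi> i j. MAX k. A $ i $ k + B $ k $ j)"

definition mp_id :: "ereal ^ 'm ^ 'm" where
  "mp_id = (\<chi> i j. if i = j then 0 else -\<infinity>)"

primrec mp_power :: "ereal ^ 'm::finite ^ 'm \<Rightarrow> nat \<Rightarrow> ereal ^ 'm ^ 'm" where
  "mp_power A 0 = mp_id"
| "mp_power A (Suc r) = A \<odot> mp_power A r"

text \<open>
  The supremum is taken in the complete lattice \<^typ>\<open>ereal\<close>; an entry \<open>\<infinity>\<close> means that the closure
  does not exist as a max-plus matrix.
\<close>

definition mp_star :: "ereal ^ 'm::finite ^ 'm \<Rightarrow> ereal ^ 'm ^ 'm" where
  "mp_star A = (\<chi> i j. SUP r. mp_power A r $ i $ j)"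

text \<open>
  A cyclic permutation of \<open>K\<close> is a permutation of \<open>K\<close> with a single orbit; \<^const>\<open>cyclic_on\<close>
  forces \<open>K\<close> to be nonempty, and singletons are included (with the identity as \<open>\<tau>\<close>).
\<close>

definition max_cycle_mean :: "ereal ^ 'm::finite ^ 'm \<Rightarrow> ereal" where
  "max_cycle_mean A =
     Max {(\<Sum>i\<in>K. A $ i $ \<tau> i) / ereal (real (card K)) | \<tau> K. \<tau> permutes K \<and> cyclic_on \<tau> K}"

definition mp_span :: "ereal ^ 'n::finite ^ 'm \<Rightarrow> (ereal ^ 'm) set" where
  "mp_span M = {(\<chi> k. MAX j. \<alpha> j + M $ k $ j) | \<alpha>. \<forall>j. \<alpha> j \<noteq> \<infinity>}"

definition full_support :: "ereal ^ 'm \<Rightarrow> bool" where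
  "full_support z \<longleftrightarrow> (\<forall>k. \<bar>z $ k\<bar> \<noteq> \<infinity>)"

definition mp_vec :: "real ^ 'm \<Rightarrow> ereal ^ 'm" where
  "mp_vec y = (\<chi> k. ereal (y $ k))"

definition cell :: "ereal ^ 'n ^ 'm \<Rightarrow> ('m \<Rightarrow> 'n set) \<Rightarrow> (real ^ 'm) set" where
  "cell V S = {y. \<forall>j k. \<forall>i\<in>S j. V $ k $ i - V $ j $ i \<le> ereal (y $ k - y $ j)}"

definition cell_matrix :: "ereal ^ 'n::finite ^ 'm \<Rightarrow> ('m \<Rightarrow> 'n set) \<Rightarrow> ereal ^ 'm ^ 'm" where
  "cell_matrix V S =
     (\<chi> k j. if S j \<noteq> {} then MAX i\<in>S j. V $ k $ i - V $ j $ i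
            else if k = j then 0 else -\<infinity>)"

end

theory Submission
  imports Defs "HOL-Combinatorics.Cycles"
begin

text \<open>
  For a matrix \<open>A\<close> with nonpositive cycle means, removing cycles from a walk does not decrease its
  weight, so every entry of \<open>A\<^sup>*\<close> is attained by a power of \<open>A\<close> and is the weight of an optimal
  walk. Every column of \<open>A\<^sup>*\<close> therefore satisfies the difference inequalities that define the cell
  of \<open>A\<close>, and the last assertion holds because each edge of an optimal walk of finite weight is
  itself optimal.
\<close>

section \<open>Walks as vertex lists, and closed walks as cyclic permutations\<close>

fun walk_weight :: "ereal ^ 'm ^ 'm \<Rightarrow> 'm list \<Rightarrow> ereal" where
  "walk_weight A (x # y # zs) = A $ x $ y + walk_weight A (y # zs)"
| "walk_weight A _ = 0"

lemma walk_weight_append: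
  "walk_weight A (xs @ y # ys) = walk_weight A (xs @ [y]) + walk_weight A (y # ys)"
  by (induction xs rule: induct_list012) (auto simp: add.assoc)

text \<open>Links walks to the sums in \<open>max_cycle_mean\<close>: along the closed walk, the
  successor of each vertex is its image under \<open>cycle_of_list\<close>.\<close>

lemma walk_weight_closed:
  assumes "distinct (x # xs)"
  shows "walk_weight A (x # xs @ [x])
    = (\<Sum>i\<in>set (x # xs). A $ i $ (cycle_of_list (x # xs) i))"
proof -
  have len: "walk_weight A (ys @ [y]) = (\<Sum>(a, b)\<leftarrow>zip ys (tl ys @ [y]). A $ a $ b)" for ys y
    by (induction ys rule: induct_list012) auto
  \<comment> \<open>Applying the cycle once to its own vertex list rotates that list by one
    place.\<close>
  have "map (cycle_of_list (x # xs)) (x # xs) = xs @ [x]"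
    using cyclic_rotation[of "x # xs" 1] assms by simp
  moreover have "zip ys (map f ys) = map (\<lambda>i. (i, f i)) ys" for f :: "'a \<Rightarrow> 'a" and ys
    by (induction ys) auto
  ultimately have "zip (x # xs) (xs @ [x]) = map (\<lambda>i. (i, cycle_of_list (x # xs) i)) (x # xs)"
    by metis
  then have "walk_weight A (x # xs @ [x])
      = (\<Sum>i\<leftarrow>x # xs. A $ i $ (cycle_of_list (x # xs) i))"
    using len[of "x # xs" x] by (simp add: comp_def del: cycle_of_list.simps)
  also have "\<dots> = (\<Sum>i\<in>set (x # xs). A $ i $ (cycle_of_list (x # xs) i))"
    using assms by (rule sum_list_distinct_conv_sum_set)
  finally show ?thesis .
qed

text \<open>The \<open>n\<close>-th iterate of the cycle carries the first vertex to the
  \<open>n\<close>-th, so all vertices lie in one orbit.\<close>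

lemma cycle_of_list_cyclic_on:
  assumes "distinct cs" "cs \<noteq> []"
  shows "cyclic_on (cycle_of_list cs) (set cs)"
proof -
  let ?f = "cycle_of_list cs"
  have perm: "?f permutes set cs"
    by (rule cycle_permutes)
  have pow: "(?f ^^ n) (cs ! 0) = cs ! n" if "n < length cs" for n
  proof -
    have "(?f ^^ n) (cs ! 0) = map (?f ^^ n) cs ! 0"
      using assms by simp
    also have "\<dots> = rotate n cs ! 0"
      using cyclic_rotation assms by metis
    also have "\<dots> = cs ! n"
      using that assms(2) by (simp add: nth_rotate)
    finally show ?thesis .
  qed
  \<comment> \<open>\<open>orbit\<close> starts at the first iterate, so that a point lies in its
    own orbit has to come from the map being a permutation of a finite set.\<close>
  have self: "cs ! 0 \<in> orbit ?f (cs ! 0)"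
    using permutation_self_in_orbit[of ?f] perm by (simp add: permutation_permutes exI[of _ "set cs"])
  have "set cs \<subseteq> orbit ?f (cs ! 0)"
  proof
    fix c assume "c \<in> set cs"
    then obtain n where "n < length cs" "c = cs ! n"
      by (auto simp: in_set_conv_nth)
    then show "c \<in> orbit ?f (cs ! 0)"
      using pow[of n] funpow_in_orbit[OF self, of n] by simp
  qed
  moreover have "orbit ?f (cs ! 0) \<subseteq> set cs"
    using permutes_orbit_subset[OF perm] assms(2) by simp
  ultimately show ?thesis
    unfolding cyclic_on_def using assms(2) by (metis nth_mem length_greater_0_conv subset_antisym)
qed

section \<open>Nonpositive cycle means and removal of cycles\<close>

lemma finite_cycle_means:
  fixes f :: "('m::finite \<Rightarrow> 'm) \<Rightarrow> 'm set \<Rightarrow> 'a"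
  shows "finite {f \<tau> K | \<tau> K. P \<tau> K}"
  by (rule finite_subset[of _ "range (\<lambda>(\<tau>, K). f \<tau> K)"]) auto

text \<open>Division by the positive length of a cycle does not affect whether its weight is
  nonpositive.\<close>

lemma max_cycle_mean_nonpos_iff:
  "max_cycle_mean A \<le> 0 \<longleftrightarrow>
    (\<forall>\<tau> K. \<tau> permutes K \<and> cyclic_on \<tau> K \<longrightarrow> (\<Sum>i\<in>K. A $ i $ \<tau> i) \<le> 0)"
proof -
  let ?M = "{(\<Sum>i\<in>K. A $ i $ \<tau> i) / ereal (real (card K)) | \<tau> K. \<tau> permutes K \<and> cyclic_on \<tau> K}"
  \<comment> \<open>A loop at an arbitrary vertex is a cycle, so the maximum ranges over a nonempty
    set.\<close>
  have "(id :: 'a \<Rightarrow> 'a) permutes {undefined}" "cyclic_on (id :: 'a \<Rightarrow> 'a) {undefined}"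
    using cycle_of_list_cyclic_on[of "[undefined :: 'a]"] by (auto intro: permutes_id)
  then have "?M \<noteq> {}"
    by blast
  then have "max_cycle_mean A \<le> 0 \<longleftrightarrow> (\<forall>v\<in>?M. v \<le> 0)"
    unfolding max_cycle_mean_def by (rule Max_le_iff[OF finite_cycle_means])
  moreover have "s / ereal (real (card K)) \<le> 0 \<longleftrightarrow> s \<le> 0" if "cyclic_on \<tau> K"
    for s and K :: "'a set" and \<tau>
  proof -
    have "card K > 0"
      using that by (auto simp: cyclic_on_def card_gt_0_iff)
    then show ?thesis
      by (subst ereal_divide_le_pos) auto
  qed
  ultimately show ?thesis
    by blast
qed

text \<open>A closed walk without repeated vertices is a cycle; any other one decomposes at a
  repeated vertex into two shorter closed walks.\<close>

lemma closed_walk_weight_nonpos: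
  assumes "max_cycle_mean A \<le> 0"
  shows "walk_weight A (x # xs @ [x]) \<le> 0"
proof (induction xs arbitrary: x rule: length_induct)
  case (1 xs)
  show ?case
  proof (cases "distinct (x # xs)")
    case True
    then show ?thesis
      unfolding walk_weight_closed[OF True]
      using assms cycle_of_list_cyclic_on[OF True] cycle_permutes[of "x # xs"]
      by (auto simp only: max_cycle_mean_nonpos_iff list.simps)
  next
    case False
    show ?thesis
    \<comment> \<open>If the base point recurs, the walk is two closed walks at \<open>x\<close> in
      succession; otherwise the inner loop at some \<open>y\<close> is cut out and the rest is still
      closed at \<open>x\<close>.\<close>
    proof (cases "x \<in> set xs")
      case True
      then obtain ys zs where xs: "xs = ys @ x # zs"
        by (auto simp: in_set_conv_decomp)
      have "walk_weight A (x # ys @ [x]) + walk_weight A (x # zs @ [x]) \<le> 0"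
        using 1 xs by (intro add_nonpos_nonpos) auto
      then show ?thesis
        using walk_weight_append[of A "x # ys" x "zs @ [x]"] xs by simp
    next
      case x: False
      with False obtain us y vs ws where xs: "xs = us @ [y] @ vs @ [y] @ ws"
        using not_distinct_decomp[of xs] by auto
      have "walk_weight A (x # xs @ [x]) = walk_weight A ((x # us) @ [y])
          + (walk_weight A (y # vs @ [y]) + walk_weight A (y # ws @ [x]))"
        using walk_weight_append[of A "x # us" y "vs @ y # ws @ [x]"]
          walk_weight_append[of A "y # vs" y "ws @ [x]"] xs by simp
      also have "\<dots> \<le> walk_weight A ((x # us) @ [y]) + (0 + walk_weight A (y # ws @ [x]))"
        using 1 xs by (intro add_mono order_refl) auto
      also have "\<dots> = walk_weight A (x # (us @ y # ws) @ [x])"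
        using walk_weight_append[of A "x # us" y "ws @ [x]"] by simp
      also have "\<dots> \<le> 0"
        using xs by (intro 1[rule_format]) simp
      finally show ?thesis .
    qed
  qed
qed

text \<open>Cutting out the segment between two visits to one vertex drops a closed walk of
  nonpositive weight, shortens the walk and keeps both ends.\<close>

lemma distinct_walk_dominates:
  assumes "max_cycle_mean A \<le> 0" "p \<noteq> []"
  shows "\<exists>q. distinct q \<and> q \<noteq> [] \<and> hd q = hd p \<and> last q = last p
    \<and> walk_weight A p \<le> walk_weight A q"
  using assms(2)
proof (induction p rule: length_induct)
  case (1 p)
  show ?case
  proof (cases "distinct p")
    case True
    then show ?thesis
      using 1 by blast
  next
    case False
    then obtain us y vs ws where p: "p = us @ [y] @ vs @ [y] @ ws"
      using not_distinct_decomp by blast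
    let ?p = "us @ y # ws"
    have "walk_weight A p = walk_weight A (us @ [y])
        + (walk_weight A (y # vs @ [y]) + walk_weight A (y # ws))"
      using walk_weight_append[of A us y "vs @ y # ws"]
        walk_weight_append[of A "y # vs" y "ws"] p by simp
    also have "\<dots> \<le> walk_weight A (us @ [y]) + (0 + walk_weight A (y # ws))"
      by (intro add_mono order_refl closed_walk_weight_nonpos[OF assms(1)])
    also have "\<dots> = walk_weight A ?p"
      using walk_weight_append[of A us y ws] by simp
    finally have le: "walk_weight A p \<le> walk_weight A ?p" .
    have "length ?p < length p" "?p \<noteq> []"
      using p by auto
    then obtain q where "distinct q" "q \<noteq> []" "hd q = hd ?p" "last q = last ?p"
      "walk_weight A ?p \<le> walk_weight A q"
      using 1 by blast
    moreover have "hd ?p = hd p" "last ?p = last p"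
      using p by (auto simp: hd_append)
    ultimately show ?thesis
      using le by (metis order_trans)
  qed
qed

section \<open>Max-plus products and powers\<close>

lemma Max_image_attained:
  assumes "finite I" "I \<noteq> {}"
  obtains i where "i \<in> I" "(MAX i\<in>I. f i) = f i"
proof -
  have "(MAX i\<in>I. f i) \<in> f ` I"
    using assms by (intro Max_in) auto
  then show ?thesis
    using that by blast
qed

lemma mp_mult_ge: "A $ i $ k + B $ k $ j \<le> (A \<odot> B) $ i $ j"
  by (simp add: mp_mult_def)

lemma mp_mult_attained:
  fixes A :: "ereal ^ 'k::finite ^ 'm"
  obtains k where "(A \<odot> B) $ i $ j = A $ i $ k + B $ k $ j"
proof -
  obtain k where "(MAX k. A $ i $ k + B $ k $ j) = A $ i $ k + B $ k $ j"
    by (rule Max_image_attained[of UNIV "\<lambda>k. A $ i $ k + B $ k $ j"]) auto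
  then show ?thesis
    by (intro that[of k]) (simp add: mp_mult_def)
qed

lemma mp_power_not_infty:
  assumes "mp_matrix A"
  shows "mp_power A r $ i $ j \<noteq> \<infinity>"
proof (induction r arbitrary: i)
  case (Suc r)
  obtain k where "mp_power A (Suc r) $ i $ j = A $ i $ k + mp_power A r $ k $ j"
    using mp_mult_attained[of A "mp_power A r"] by auto
  then show ?case
    using assms Suc[of k] by (simp add: mp_matrix_def)
qed (simp add: mp_id_def)

lemma mp_power_add_ge:
  assumes "mp_matrix A"
  shows "mp_power A r $ i $ k + mp_power A s $ k $ j \<le> mp_power A (r + s) $ i $ j"
proof (induction r arbitrary: i)
  case 0
  then show ?case
    \<comment> \<open>An entry \<open>-\<infinity>\<close> of the identity absorbs the second
      summand only if that is not \<open>\<infinity>\<close>.\<close>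
    using mp_power_not_infty[OF assms, of s k j]
    by (cases "mp_power A s $ k $ j") (auto simp: mp_id_def)
next
  case (Suc r)
  obtain l where "mp_power A (Suc r) $ i $ k = A $ i $ l + mp_power A r $ l $ k"
    using mp_mult_attained[of A "mp_power A r"] by auto
  then have "mp_power A (Suc r) $ i $ k + mp_power A s $ k $ j
      \<le> A $ i $ l + mp_power A (r + s) $ l $ j"
    using Suc[of l] by (simp add: add.assoc add_left_mono)
  also have "\<dots> \<le> mp_power A (Suc r + s) $ i $ j"
    by (simp add: mp_mult_ge)
  finally show ?case .
qed

text \<open>An entry of the \<open>r\<close>-th power is the best weight of a walk with
  \<open>r\<close> edges; a list of vertices has one edge fewer than its length.\<close>

lemma walk_weight_le_mp_power:
  "p \<noteq> [] \<Longrightarrow> walk_weight A p \<le> mp_power A (length p - 1) $ hd p $ last p"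
proof (induction A p rule: walk_weight.induct)
  case (1 A x y zs)
  then have "A $ x $ y + walk_weight A (y # zs)
      \<le> A $ x $ y + mp_power A (length zs) $ y $ last (y # zs)"
    by (intro add_left_mono) simp
  also have "\<dots> \<le> mp_power A (Suc (length zs)) $ x $ last (y # zs)"
    by (simp add: mp_mult_ge)
  finally show ?case
    by simp
qed (auto simp: mp_id_def)

text \<open>Choosing a maximizing index in each factor traces out a walk. The value
  \<open>-\<infinity>\<close> is set apart because off-diagonal entries of the zeroth power come
  from no walk.\<close>

lemma mp_power_attained:
  assumes "mp_matrix A" "mp_power A r $ i $ j \<noteq> -\<infinity>"
  shows "\<exists>p. p \<noteq> [] \<and> hd p = i \<and> last p = j \<and> walk_weight A p = mp_power A r $ i $ j"
  using assms(2)
proof (induction r arbitrary: i)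
  case 0
  then show ?case
    by (intro exI[of _ "[i]"]) (auto simp: mp_id_def split: if_splits)
next
  case (Suc r)
  obtain k where k: "mp_power A (Suc r) $ i $ j = A $ i $ k + mp_power A r $ k $ j"
    using mp_mult_attained[of A "mp_power A r"] by auto
  \<comment> \<open>As \<open>\<infinity> + (-\<infinity>) = \<infinity>\<close>, a sum other than
    \<open>-\<infinity>\<close> says something about the tail only once the edge is not
    \<open>\<infinity>\<close>.\<close>
  moreover have "A $ i $ k \<noteq> \<infinity>"
    using assms(1) by (simp add: mp_matrix_def)
  ultimately have "mp_power A r $ k $ j \<noteq> -\<infinity>"
    using Suc.prems by (cases "A $ i $ k") auto
  then obtain p where p: "p \<noteq> []" "hd p = k" "last p = j" "walk_weight A p = mp_power A r $ k $ j"
    using Suc.IH by blast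
  then have "walk_weight A (i # p) = mp_power A (Suc r) $ i $ j"
    using k by (cases p) auto
  then show ?case
    using p by (intro exI[of _ "i # p"]) auto
qed

section \<open>The closure and its triangle inequality\<close>

lemma mp_power_le_mp_star: "mp_power A r $ i $ j \<le> mp_star A $ i $ j"
  unfolding mp_star_def vec_lambda_beta by (rule SUP_upper) (rule UNIV_I)

lemma le_mp_star: "A $ i $ j \<le> mp_star A $ i $ j"
proof -
  have "A $ i $ j = A $ i $ j + mp_power A 0 $ j $ j"
    by (simp add: mp_id_def)
  also have "\<dots> \<le> mp_power A (Suc 0) $ i $ j"
    by (simp only: mp_power.simps mp_mult_ge)
  also have "\<dots> \<le> mp_star A $ i $ j"
    by (rule mp_power_le_mp_star)
  finally show ?thesis .
qed

text \<open>Every walk is dominated by one without repetitions, hence with at most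
  \<open>CARD('m)\<close> vertices. The supremum is thus a maximum over finitely many
  powers.\<close>

lemma mp_star_attained:
  fixes A :: "ereal ^ 'm::finite ^ 'm"
  assumes "mp_matrix A" "max_cycle_mean A \<le> 0"
  obtains r where "mp_star A $ i $ j = mp_power A r $ i $ j"
proof -
  let ?N = "CARD('m)"
  let ?B = "MAX r\<in>{..?N}. mp_power A r $ i $ j"
  have "mp_power A r $ i $ j \<le> ?B" for r
  proof (cases "mp_power A r $ i $ j = -\<infinity>")
    case False
    then obtain p where p: "p \<noteq> []" "hd p = i" "last p = j"
      "walk_weight A p = mp_power A r $ i $ j"
      using mp_power_attained[OF assms(1)] by blast
    then obtain q where q: "distinct q" "q \<noteq> []" "hd q = i" "last q = j"
      "walk_weight A p \<le> walk_weight A q"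
      using distinct_walk_dominates[OF assms(2) p(1)] by auto
    have "length q \<le> ?N"
      using q(1) by (metis distinct_card card_mono finite subset_UNIV)
    then have len: "length q - 1 \<in> {..?N}"
      by simp
    have "mp_power A r $ i $ j \<le> walk_weight A q"
      using p(4) q(5) by simp
    also have "\<dots> \<le> mp_power A (length q - 1) $ i $ j"
      using walk_weight_le_mp_power[OF q(2), of A] q(3,4) by simp
    also have "\<dots> \<le> ?B"
      using len by (intro Max_ge finite_imageI finite_atMost imageI)
    finally show ?thesis .
  qed simp
  then have "mp_star A $ i $ j \<le> ?B"
    unfolding mp_star_def vec_lambda_beta by (rule SUP_least)
  moreover have "finite {..?N}" "{..?N} \<noteq> {}"
    by auto
  then obtain r where "r \<in> {..?N}" "?B = mp_power A r $ i $ j"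
    by (rule Max_image_attained)
  ultimately have "mp_star A $ i $ j \<le> mp_power A r $ i $ j"
    by (simp only:)
  then have "mp_star A $ i $ j = mp_power A r $ i $ j"
    by (rule antisym[OF _ mp_power_le_mp_star])
  then show ?thesis
    by (rule that)
qed

lemma mp_star_not_infty:
  assumes "mp_matrix A" "max_cycle_mean A \<le> 0"
  shows "mp_star A $ i $ j \<noteq> \<infinity>"
  by (rule mp_star_attained[OF assms, of i j]) (simp add: mp_power_not_infty[OF assms(1)])

lemma mp_star_diag_nonneg: "0 \<le> mp_star A $ i $ i"
  using mp_power_le_mp_star[of A 0 i i] by (simp add: mp_id_def)

text \<open>Optimal walks from \<open>i\<close> to \<open>k\<close> and from \<open>k\<close> to
  \<open>j\<close> can be concatenated: if the powers \<open>r\<close> and \<open>s\<close> attain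
  the two entries, the power \<open>r + s\<close> dominates their sum.\<close>

lemma mp_star_triangle:
  assumes "mp_matrix A" "max_cycle_mean A \<le> 0"
  shows "mp_star A $ i $ k + mp_star A $ k $ j \<le> mp_star A $ i $ j"
proof -
  obtain r s where "mp_star A $ i $ k = mp_power A r $ i $ k"
    "mp_star A $ k $ j = mp_power A s $ k $ j"
    using mp_star_attained[OF assms] by meson
  then show ?thesis
    using mp_power_add_ge[OF assms(1), of r i k s j] mp_power_le_mp_star[of A "r + s" i j] by simp
qed

section \<open>Potentials, the finite solutions of \<open>A \<odot> x \<le> x\<close>, and the span
  of the closure\<close>

definition potentials :: "ereal ^ 'm ^ 'm \<Rightarrow> (real ^ 'm) set" where
  "potentials A = {x. \<forall>i j. A $ i $ j \<le> ereal (x $ i - x $ j)}"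

text \<open>The edge inequalities add up along a walk, and the potential differences
  telescope.\<close>

lemma mp_power_le_potential:
  assumes "x \<in> potentials A"
  shows "mp_power A r $ i $ j \<le> ereal (x $ i - x $ j)"
proof (induction r arbitrary: i)
  case (Suc r)
  obtain k where "mp_power A (Suc r) $ i $ j = A $ i $ k + mp_power A r $ k $ j"
    using mp_mult_attained[of A "mp_power A r"] by auto
  also have "\<dots> \<le> ereal (x $ i - x $ k) + ereal (x $ k - x $ j)"
    using assms Suc by (intro add_mono) (auto simp: potentials_def)
  finally show ?case
    by simp
qed (auto simp: mp_id_def zero_ereal_def)

lemma mp_star_le_potential:
  assumes "x \<in> potentials A"
  shows "mp_star A $ i $ j \<le> ereal (x $ i - x $ j)"
  using mp_power_le_potential[OF assms] by (auto simp: mp_star_def intro: SUP_least)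

text \<open>Around a cycle the potential differences sum to 0, since \<open>\<tau>\<close> only
  permutes the terms.\<close>

lemma max_cycle_mean_nonpos_if_potential:
  assumes "x \<in> potentials A"
  shows "max_cycle_mean A \<le> 0"
  unfolding max_cycle_mean_nonpos_iff
proof safe
  fix \<tau> :: "'a \<Rightarrow> 'a" and K
  assume perm: "\<tau> permutes K"
  have "(\<Sum>i\<in>K. A $ i $ \<tau> i) \<le> (\<Sum>i\<in>K. ereal (x $ i - x $ \<tau> i))"
    using assms by (intro sum_mono) (auto simp: potentials_def)
  also have "\<dots> = ereal ((\<Sum>i\<in>K. x $ i) - (\<Sum>i\<in>K. x $ \<tau> i))"
    by (simp add: sum_subtractf)
  also have "(\<Sum>i\<in>K. x $ \<tau> i) = (\<Sum>i\<in>K. x $ i)"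
    using sum.permute[OF perm, of "\<lambda>i. x $ i"] by (simp add: comp_def)
  finally show "(\<Sum>i\<in>K. A $ i $ \<tau> i) \<le> 0"
    by (simp add: zero_ereal_def)
qed

text \<open>The components of \<open>x\<close> serve as its own coefficients: each term is at most
  \<open>x $ k\<close>, and the term \<open>j = k\<close> reaches it because the closure has a
  nonnegative diagonal.\<close>

lemma mp_vec_potential_in_span:
  assumes "x \<in> potentials A"
  shows "mp_vec x \<in> mp_span (mp_star A)"
proof -
  have "(MAX j. ereal (x $ j) + mp_star A $ k $ j) = ereal (x $ k)" for k
  proof (rule antisym)
    have "ereal (x $ j) + mp_star A $ k $ j \<le> ereal (x $ k)" for j
      using add_left_mono[OF mp_star_le_potential[OF assms, of k j], of "ereal (x $ j)"] by simp
    then show "(MAX j. ereal (x $ j) + mp_star A $ k $ j) \<le> ereal (x $ k)"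
      by simp
    have "ereal (x $ k) \<le> ereal (x $ k) + mp_star A $ k $ k"
      using add_left_mono[OF mp_star_diag_nonneg[of A k], of "ereal (x $ k)"] by simp
    also have "\<dots> \<le> (MAX j. ereal (x $ j) + mp_star A $ k $ j)"
      by (rule Max_ge) auto
    finally show "ereal (x $ k) \<le> (MAX j. ereal (x $ j) + mp_star A $ k $ j)" .
  qed
  then show ?thesis
    unfolding mp_span_def mp_vec_def
    by (intro CollectI exI[of _ "\<lambda>j. ereal (x $ j)"]) auto
qed

text \<open>Each column \<open>c\<close> of the closure satisfies
  \<open>A $ i $ k + c $ k \<le> c $ i\<close> by the triangle inequality. This survives shifts and
  maxima, and full support allows subtracting \<open>z $ k\<close>.\<close>

lemma span_full_support_potential:
  assumes "mp_matrix A" "max_cycle_mean A \<le> 0"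
    and "z \<in> mp_span (mp_star A)" "full_support z"
  shows "z \<in> mp_vec ` potentials A"
proof -
  obtain \<alpha> where z: "z = (\<chi> k. MAX j. \<alpha> j + mp_star A $ k $ j)"
    using assms(3) by (auto simp: mp_span_def)
  define x :: "real ^ 'a" where "x = (\<chi> k. real_of_ereal (z $ k))"
  have zx: "z $ k = ereal (x $ k)" for k
    using assms(4) by (simp add: x_def full_support_def ereal_real')
  have "A $ i $ k \<le> ereal (x $ i - x $ k)" for i k
  proof -
    obtain j where "(MAX j. \<alpha> j + mp_star A $ k $ j) = \<alpha> j + mp_star A $ k $ j"
      by (rule Max_image_attained[of UNIV "\<lambda>j. \<alpha> j + mp_star A $ k $ j"]) auto
    then have "z $ k = \<alpha> j + mp_star A $ k $ j"
      by (simp add: z)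
    then have "A $ i $ k + z $ k = \<alpha> j + (A $ i $ k + mp_star A $ k $ j)"
      by (simp add: ac_simps)
    also have "\<dots> \<le> \<alpha> j + mp_star A $ i $ j"
      using le_mp_star[of A i k] mp_star_triangle[OF assms(1,2), of i k j]
      by (intro add_left_mono) (meson add_right_mono order_trans)
    also have "\<dots> \<le> z $ i"
      by (simp add: z)
    finally show ?thesis
      unfolding zx by (cases "A $ i $ k") auto
  qed
  then have "x \<in> potentials A"
    by (simp add: potentials_def)
  moreover have "z = mp_vec x"
    by (simp add: vec_eq_iff mp_vec_def zx)
  ultimately show ?thesis
    by blast
qed

lemma mp_vec_image_potentials:
  assumes "mp_matrix A" "max_cycle_mean A \<le> 0"
  shows "mp_vec ` potentials A = {z \<in> mp_span (mp_star A). full_support z}"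
  using span_full_support_potential[OF assms] mp_vec_potential_in_span
  by (auto simp: full_support_def mp_vec_def)

text \<open>The maximum of all columns of the closure is a witness: it is nonnegative because of the
  diagonal, and no entry is \<open>\<infinity>\<close>.\<close>

lemma potentials_nonempty:
  assumes "mp_matrix A" "max_cycle_mean A \<le> 0"
  shows "potentials A \<noteq> {}"
proof -
  let ?z = "\<chi> k. MAX j. 0 + mp_star A $ k $ j"
  have "?z \<in> mp_span (mp_star A)"
    unfolding mp_span_def by (intro CollectI exI[of _ "\<lambda>_. 0"]) simp
  moreover have "\<bar>?z $ k\<bar> \<noteq> \<infinity>" for k
  proof -
    obtain j where "(MAX j. 0 + mp_star A $ k $ j) = 0 + mp_star A $ k $ j"
      by (rule Max_image_attained[of UNIV "\<lambda>j. 0 + mp_star A $ k $ j"]) auto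
    then have "?z $ k \<noteq> \<infinity>"
      using mp_star_not_infty[OF assms, of k j] by simp
    moreover have "0 \<le> ?z $ k"
      using mp_star_diag_nonneg[of A k] by (auto simp: Max_ge_iff)
    ultimately show ?thesis
      by auto
  qed
  ultimately have "?z \<in> mp_vec ` potentials A"
    using span_full_support_potential[OF assms] unfolding full_support_def by blast
  then show ?thesis
    by blast
qed

section \<open>Reduction to the entries where a matrix agrees with its closure\<close>

lemma ereal_add_eq_add_imp_eq:
  fixes a b c d :: ereal
  assumes "a \<le> c" "b \<le> d" "c + d \<le> a + b" "a + b \<noteq> -\<infinity>" "c \<noteq> \<infinity>" "d \<noteq> \<infinity>"
  shows "a = c" "b = d"
  using assms by (cases a; cases b; cases c; cases d; simp)+

text \<open>Adding the assumed inequalities over the edges of an optimal walk bounds the closure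
  entry by the potential difference, and the matrix lies below its closure.\<close>

lemma potential_if_critical:
  assumes "mp_matrix A" "max_cycle_mean A \<le> 0"
    and crit: "\<And>i j. \<lbrakk>i \<noteq> j; A $ i $ j = mp_star A $ i $ j\<rbrakk> \<Longrightarrow> A $ i $ j \<le> ereal (x $ i - x $ j)"
  shows "x \<in> potentials A"
proof -
  \<comment> \<open>\<open>crit\<close> covers distinct indices only; loops are bounded by the cycle
    condition.\<close>
  have diag: "A $ i $ i \<le> 0" for i
    using closed_walk_weight_nonpos[OF assms(2), of i "[]"] by simp
  have step: "mp_star A $ i $ j \<le> ereal (x $ i - x $ j)"
    if "mp_power A r $ i $ j = mp_star A $ i $ j" for r i j
    using that
  proof (induction r arbitrary: i)
    case 0
    then have "mp_star A $ i $ j = (if i = j then 0 else -\<infinity>)"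
      by (simp add: mp_id_def)
    then show ?case
      by simp
  next
    case (Suc r)
    show ?case
    proof (cases "mp_star A $ i $ j = -\<infinity>")
      case False
      obtain k where "mp_power A (Suc r) $ i $ j = A $ i $ k + mp_power A r $ k $ j"
        using mp_mult_attained[of A "mp_power A r"] by auto
      then have eq: "mp_star A $ i $ j = A $ i $ k + mp_power A r $ k $ j"
        using Suc.prems by simp
      \<comment> \<open>Each closure entry dominates its part of the walk, yet their sum is at most
        the total weight; as that is not \<open>-\<infinity>\<close>, both the first edge and the
        tail are optimal.\<close>
      have le: "mp_star A $ i $ k + mp_star A $ k $ j \<le> A $ i $ k + mp_power A r $ k $ j"
        using mp_star_triangle[OF assms(1,2)] eq by metis
      have "A $ i $ k = mp_star A $ i $ k" "mp_power A r $ k $ j = mp_star A $ k $ j"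
        using ereal_add_eq_add_imp_eq[OF le_mp_star mp_power_le_mp_star le] eq False
          mp_star_not_infty[OF assms(1,2)] by simp_all
      then have "mp_power A r $ k $ j \<le> ereal (x $ k - x $ j)"
        using Suc.IH[of k] by simp
      moreover have "A $ i $ k \<le> ereal (x $ i - x $ k)"
      proof (cases "i = k")
        case True
        then show ?thesis
          using diag[of k] by (simp add: zero_ereal_def)
      next
        case False
        then show ?thesis
          using \<open>A $ i $ k = mp_star A $ i $ k\<close> by (rule crit)
      qed
      ultimately have "mp_star A $ i $ j \<le> ereal (x $ i - x $ k) + ereal (x $ k - x $ j)"
        unfolding eq by (rule add_mono[rotated])
      then show ?thesis
        by simp
    qed simp
  qed
  have "A $ i $ j \<le> ereal (x $ i - x $ j)" for i j
  proof -
    obtain r where "mp_star A $ i $ j = mp_power A r $ i $ j"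
      by (rule mp_star_attained[OF assms(1,2)])
    from step[OF this[symmetric]] show ?thesis
      by (rule order_trans[OF le_mp_star])
  qed
  then show ?thesis
    by (simp add: potentials_def)
qed

section \<open>Cells as potentials of the cell matrix\<close>

lemma cell_eq_potentials: "cell V S = potentials (cell_matrix V S)"
proof -
  have "cell_matrix V S $ k $ j \<le> ereal (y $ k - y $ j) \<longleftrightarrow>
      (\<forall>i\<in>S j. V $ k $ i - V $ j $ i \<le> ereal (y $ k - y $ j))" for y k j
    by (auto simp: cell_matrix_def)
  then show ?thesis
    by (auto simp: cell_def potentials_def)
qed

text \<open>A difference of entries of \<open>V\<close> could be \<open>\<infinity>\<close> only by
  subtracting \<open>-\<infinity>\<close>, which membership in \<open>S j\<close> excludes.\<close>

lemma mp_matrix_cell_matrix: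
  assumes "mp_matrix V" "\<And>i j. i \<in> S j \<Longrightarrow> V $ j $ i \<noteq> -\<infinity>"
  shows "mp_matrix (cell_matrix V S)"
proof -
  have "cell_matrix V S $ k $ j \<noteq> \<infinity>" for k j
  proof (cases "S j = {}")
    case False
    then obtain i where "i \<in> S j" "(MAX i\<in>S j. V $ k $ i - V $ j $ i) = V $ k $ i - V $ j $ i"
      by (rule Max_image_attained[OF finite])
    with False have i: "i \<in> S j" "cell_matrix V S $ k $ j = V $ k $ i - V $ j $ i"
      by (simp_all add: cell_matrix_def)
    have "V $ k $ i \<noteq> \<infinity>"
      using assms(1) by (simp add: mp_matrix_def)
    then show ?thesis
      using i assms(2)[OF i(1)] by (cases "V $ k $ i"; cases "V $ j $ i") auto
  qed (simp add: cell_matrix_def)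
  then show ?thesis
    by (simp add: mp_matrix_def)
qed

theorem proposition13:
  fixes V :: "ereal ^ 'n::finite ^ 'm::finite" and S :: "'m \<Rightarrow> 'n set"
  assumes "mp_matrix V"
    and "\<And>i. \<exists>j. V $ j $ i \<noteq> -\<infinity>"
    and "\<And>i j. i \<in> S j \<Longrightarrow> V $ j $ i \<noteq> -\<infinity>"
  shows "(cell V S \<noteq> {} \<longleftrightarrow> max_cycle_mean (cell_matrix V S) \<le> 0) \<and>
    (max_cycle_mean (cell_matrix V S) \<le> 0 \<longrightarrow>
       mp_vec ` cell V S = {z \<in> mp_span (mp_star (cell_matrix V S)). full_support z}) \<and>
    (max_cycle_mean (cell_matrix V S) \<le> 0 \<longrightarrow>
       cell V S = {x. \<forall>i j. i \<noteq> j \<and>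
         cell_matrix V S $ i $ j = mp_star (cell_matrix V S) $ i $ j \<longrightarrow>
         cell_matrix V S $ i $ j \<le> ereal (x $ i - x $ j)})"
proof -
  let ?A = "cell_matrix V S"
  have A: "mp_matrix ?A"
    using assms(1,3) by (rule mp_matrix_cell_matrix)
  show ?thesis
    \<comment> \<open>All three claims become statements on the potentials of the single matrix
      \<open>?A\<close>. For empty \<open>S j\<close> the column of \<open>?A\<close> imposes only
      inequalities that always hold, as the cell does.\<close>
    unfolding cell_eq_potentials
  proof (intro conjI impI)
    show "potentials ?A \<noteq> {} \<longleftrightarrow> max_cycle_mean ?A \<le> 0"
      using max_cycle_mean_nonpos_if_potential potentials_nonempty[OF A] by blast
    assume mean: "max_cycle_mean ?A \<le> 0"
    show "mp_vec ` potentials ?A = {z \<in> mp_span (mp_star ?A). full_support z}"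
      by (rule mp_vec_image_potentials[OF A mean])
    show "potentials ?A = {x. \<forall>i j. i \<noteq> j \<and> ?A $ i $ j = mp_star ?A $ i $ j \<longrightarrow>
        ?A $ i $ j \<le> ereal (x $ i - x $ j)}" (is "_ = ?C")
    proof (intro equalityI subsetI)
      fix x assume "x \<in> potentials ?A"
      then show "x \<in> ?C"
        unfolding potentials_def by blast
    next
      fix x assume "x \<in> ?C"
      then show "x \<in> potentials ?A"
        by (intro potential_if_critical[OF A mean]) blast
    qed
  qed
qed

end
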